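(* Let $\mathcal{P}$ be a player that, for every integer $k>1$, is guaranteed to solve (win) the $k$-hitting game in $f(k)$ rounds with probability at least $1-\frac1k$ (i.e., against every referee, $\mathcal{P}$ wins within its first $f(k)$ rounds with probability at least $1-\frac1k$). Then $f(k)\in\Omega(\log^2 k)$.
   Context: The $k$-hitting game ($k>1$ an integer) is played between a player and a referee. At the beginning the referee secretly selects a non-empty target set $T\subseteq\{1,\dots,k\}$. The game proceeds in rounds. In each round the player generates a proposal $P\subseteq\{1,\dots,k\}$. If $|P\cap T|=1$ the player wins the game; otherwise it moves on to the next round, learning nothing except that its proposal failed. Both player and referee are probabilistic automata (they may use randomness); the player does not know the definition of the referee, and the referee does not know the player's random bits (so $T$ is chosen independently of the player's randomness). The player's strategy may depend on $k$. Asymptotics are as $k\to\infty$. *)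

theory Defs
  imports "HOL-Probability.Probability" "HOL-Library.Landau_Symbols"
begin

text \<open>
  A player is a probabilistic automaton (discrete distributions, arbitrary state space).
  The only feedback a player ever receives is that the game goes on, that is, that its
  proposal failed; hence the transition distribution needs no input besides the current state.
  One transition yields the proposal of the round together with the state in which
  the next round is entered if that proposal fails.
\<close>

record 's player =
  states :: "'s set"
  start :: "'s pmf"
  trans_dist :: "'s \<Rightarrow> (nat set \<times> 's) pmf"

definition hitting_player :: "nat \<Rightarrow> 's player \<Rightarrow> bool" where
  "hitting_player k A \<longleftrightarrow>
     set_pmf (start A) \<subseteq> states A \<and>
     (\<forall>s \<in> states A. set_pmf (trans_dist A s) \<subseteq> Pow {1..k} \<times> states A)"

text \<open>
  The one choice of a referee is the target set, made once and for all at the beginning.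
  A referee is therefore given by the distribution of that set.
\<close>

definition hitting_referee :: "nat \<Rightarrow> nat set pmf \<Rightarrow> bool" where
  "hitting_referee k R \<longleftrightarrow> set_pmf R \<subseteq> {T. T \<noteq> {} \<and> T \<subseteq> {1..k}}"

text \<open>
  The distribution of the outcome (has the player won?) of \<open>n\<close> rounds
  against the target set \<open>T\<close>, entered in state \<open>s\<close>.
\<close>

fun play_rounds :: "'s player \<Rightarrow> nat set \<Rightarrow> nat \<Rightarrow> 's \<Rightarrow> bool pmf" where
  "play_rounds A T 0 s = return_pmf False"
| "play_rounds A T (Suc n) s =
     bind_pmf (trans_dist A s)
       (\<lambda>(P, s'). if card (P \<inter> T) = 1 then return_pmf True else play_rounds A T n s')"

text \<open>
  Target set and start state are drawn independently, and the transition distributions of the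
  player do not depend on the target set.
\<close>

definition hitting_game :: "'s player \<Rightarrow> nat set pmf \<Rightarrow> nat \<Rightarrow> bool pmf" where
  "hitting_game A R n =
     bind_pmf R (\<lambda>T. bind_pmf (start A) (\<lambda>s. play_rounds A T n s))"

definition win_prob :: "'s player \<Rightarrow> nat set pmf \<Rightarrow> nat \<Rightarrow> real" where
  "win_prob A R n = pmf (hitting_game A R n) True"

end

theory Submission
  imports Defs
begin

text \<open>
  Against fixed targets, averaging over the player's randomness yields, for any weighting \<open>w\<close> of
  the targets, one list of proposals whose missed targets have at most a \<open>1/k\<close> fraction of the
  weight. Let \<open>w\<close> be the sum over the scales \<open>i = 1, \<dots>, L\<close>, with \<open>L\<close> of order
  \<open>log k\<close>, of the law of a random subset of density \<open>q = 2 powr (-i)\<close>. At scale \<open>i\<close> a random target is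
  missed by all proposals if it avoids a set \<open>S\<^sub>i\<close> that swallows the small proposals, and meets
  every other proposal \<open>P\<close> at least twice outside \<open>S\<^sub>i\<close>. These events are increasing
  outside \<open>S\<^sub>i\<close>, so by Harris' inequality they hold simultaneously with probability at least
  \<open>q exp(-cost\<^sub>i)\<close>, where \<open>cost\<^sub>i\<close> is \<open>2 q |S\<^sub>i|\<close> plus a sum of terms of order
  \<open>1 / (q |P - S\<^sub>i|)\<close>. Building the \<open>S\<^sub>i\<close> as an increasing chain makes each proposal contribute
  only \<open>O(1)\<close> to \<open>\<Sum>cost\<^sub>i\<close>. With \<open>n\<close> proposals some scale therefore costs \<open>O(n / L)\<close>, and
  \<open>exp(-O(n / L))\<close> cannot be as small as a power of \<open>1/k\<close> unless \<open>n\<close> is of order \<open>L\<^sup>2\<close>.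
\<close>

subsection \<open>Random subsets and Harris' inequality\<close>

text \<open>The expectation of \<open>f\<close> over a random subset of \<open>U\<close> that
  contains each element independently with probability \<open>q\<close>. Written as a finite sum, it
  allows induction on \<open>U\<close> by plain algebra.\<close>

definition bernoulli_sum :: "'a set \<Rightarrow> real \<Rightarrow> ('a set \<Rightarrow> real) \<Rightarrow> real" where
  "bernoulli_sum U q f = (\<Sum>T\<in>Pow U. q ^ card T * (1 - q) ^ card (U - T) * f T)"

lemma bernoulli_sum_empty [simp]: "bernoulli_sum {} q f = f {}"
  by (simp add: bernoulli_sum_def)

lemma bernoulli_sum_insert:
  assumes "finite U" "x \<notin> U"
  shows "bernoulli_sum (insert x U) q f =
    (1 - q) * bernoulli_sum U q f + q * bernoulli_sum U q (\<lambda>T. f (insert x T))"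
proof -
  let ?h = "\<lambda>T. q ^ card T * (1 - q) ^ card (insert x U - T) * f T"
  have inj: "inj_on (insert x) (Pow U)"
    using assms by (auto simp: inj_on_def)
  have disj: "Pow U \<inter> insert x ` Pow U = {}"
    using assms by auto
  have "bernoulli_sum (insert x U) q f = sum ?h (Pow U) + sum ?h (insert x ` Pow U)"
    unfolding bernoulli_sum_def Pow_insert using assms disj
    by (intro sum.union_disjoint) auto
  also have "sum ?h (Pow U) = (1 - q) * bernoulli_sum U q f"
    unfolding bernoulli_sum_def sum_distrib_left
  proof (rule sum.cong)
    fix T assume "T \<in> Pow U"
    then have "insert x U - T = insert x (U - T)"
      using assms by auto
    then have "card (insert x U - T) = Suc (card (U - T))"
      using assms by simp
    then show "?h T = (1 - q) * (q ^ card T * (1 - q) ^ card (U - T) * f T)"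
      by simp
  qed simp
  also have "sum ?h (insert x ` Pow U) = q * bernoulli_sum U q (\<lambda>T. f (insert x T))"
    unfolding bernoulli_sum_def sum_distrib_left sum.reindex[OF inj] o_def
  proof (rule sum.cong)
    fix T assume T: "T \<in> Pow U"
    then have "insert x U - insert x T = U - T" "x \<notin> T" "finite T"
      using assms finite_subset by auto
    then show "?h (insert x T) = q * (q ^ card T * (1 - q) ^ card (U - T) * f (insert x T))"
      by simp
  qed simp
  finally show ?thesis .
qed

lemma bernoulli_sum_const:
  assumes "finite U"
  shows "bernoulli_sum U q (\<lambda>_. c) = c"
  using assms by (induction U) (auto simp: bernoulli_sum_insert algebra_simps)

lemma bernoulli_sum_mono:
  assumes "0 \<le> q" "q \<le> 1" "\<And>T. T \<subseteq> U \<Longrightarrow> f T \<le> g T"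
  shows "bernoulli_sum U q f \<le> bernoulli_sum U q g"
  unfolding bernoulli_sum_def using assms by (intro sum_mono mult_left_mono) auto

lemma bernoulli_sum_diff:
  "bernoulli_sum U q (\<lambda>T. f T - g T) = bernoulli_sum U q f - bernoulli_sum U q g"
  by (simp add: bernoulli_sum_def sum_subtractf right_diff_distrib)

text \<open>The weights factor over \<open>A\<close> and \<open>U - A\<close>, so restricting to the
  event of avoiding \<open>A\<close> leaves a random subset of \<open>U - A\<close> of the same
  density.\<close>

lemma bernoulli_sum_avoid:
  assumes "finite U" "A \<subseteq> U"
  shows "bernoulli_sum U q (\<lambda>T. of_bool (T \<inter> A = {}) * f T) =
    (1 - q) ^ card A * bernoulli_sum (U - A) q f"
proof -
  have "bernoulli_sum U q (\<lambda>T. of_bool (T \<inter> A = {}) * f T) =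
      (\<Sum>T\<in>Pow (U - A). q ^ card T * (1 - q) ^ card (U - T) * f T)"
    unfolding bernoulli_sum_def
    by (rule sum.mono_neutral_cong_right) (use assms in auto)
  also have "\<dots> = (1 - q) ^ card A * bernoulli_sum (U - A) q f"
    unfolding bernoulli_sum_def sum_distrib_left
  proof (rule sum.cong)
    fix T assume "T \<in> Pow (U - A)"
    then have "U - T = A \<union> (U - A - T)" using assms by auto
    then have "card (U - T) = card A + card (U - A - T)"
      using assms by (metis card_Un_disjoint Diff_disjoint finite_Diff finite_subset Diff_eq Int_assoc
          Int_empty_left)
    then show "q ^ card T * (1 - q) ^ card (U - T) * f T =
        (1 - q) ^ card A * (q ^ card T * (1 - q) ^ card (U - A - T) * f T)"
      by (simp add: power_add)
  qed simp
  finally show ?thesis .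
qed

lemma bernoulli_sum_hit:
  assumes "finite U" "A \<subseteq> U"
  shows "bernoulli_sum U q (\<lambda>T. of_bool (T \<inter> A \<noteq> {})) = 1 - (1 - q) ^ card A"
proof -
  have "bernoulli_sum U q (\<lambda>T. of_bool (T \<inter> A \<noteq> {})) =
      bernoulli_sum U q (\<lambda>T. 1 - of_bool (T \<inter> A = {}) * 1)"
    by (intro arg_cong[where f = "bernoulli_sum U q"] ext) auto
  also have "\<dots> = 1 - (1 - q) ^ card A"
    unfolding bernoulli_sum_diff bernoulli_sum_avoid[OF assms]
    using assms by (simp add: bernoulli_sum_const)
  finally show ?thesis .
qed

text \<open>Induction on the ground set. Splitting on whether \<open>x\<close> is drawn leaves a
  two-point inequality whose sides differ by \<open>q * (1 - q) * ((F1 - F0) * (G1 - G0))\<close>;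
  monotonicity makes both differences non-negative.\<close>

lemma harris_inequality:
  fixes f g :: "'a set \<Rightarrow> real"
  assumes "finite U" "0 \<le> q" "q \<le> 1" "mono f" "mono g"
  shows "bernoulli_sum U q f * bernoulli_sum U q g \<le> bernoulli_sum U q (\<lambda>T. f T * g T)"
  using assms(1,4,5)
proof (induction U arbitrary: f g)
  case empty
  then show ?case by simp
next
  case (insert x U)
  let ?f = "\<lambda>T. f (insert x T)" and ?g = "\<lambda>T. g (insert x T)"
  define F0 F1 G0 G1 where "F0 = bernoulli_sum U q f" "F1 = bernoulli_sum U q ?f"
    "G0 = bernoulli_sum U q g" "G1 = bernoulli_sum U q ?g"
  note defs = this
  have "mono (\<lambda>T. u (insert x T))" if "mono u" for u :: "'a set \<Rightarrow> real"
    by (intro monoI monoD[OF that]) auto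
  then have m: "mono ?f" "mono ?g"
    using insert.prems by auto
  have "F0 \<le> F1" "G0 \<le> G1"
    unfolding defs
    using insert.prems by (intro bernoulli_sum_mono assms; meson monoD subset_insertI)+
  then have "0 \<le> q * (1 - q) * ((F1 - F0) * (G1 - G0))"
    using assms by simp
  then have "((1 - q) * F0 + q * F1) * ((1 - q) * G0 + q * G1) \<le>
      (1 - q) * (F0 * G0) + q * (F1 * G1)"
    by (simp add: algebra_simps)
  also have "\<dots> \<le> (1 - q) * bernoulli_sum U q (\<lambda>T. f T * g T)
      + q * bernoulli_sum U q (\<lambda>T. ?f T * ?g T)"
    using insert.IH[OF insert.prems] insert.IH[OF m] assms unfolding defs
    by (intro add_mono mult_left_mono) auto
  finally show ?case
    using insert.hyps by (simp add: bernoulli_sum_insert defs)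
qed

lemma harris_inequality_prod:
  fixes f :: "'i \<Rightarrow> 'a set \<Rightarrow> real"
  assumes "finite I" "finite U" "0 \<le> q" "q \<le> 1"
    and "\<And>i. i \<in> I \<Longrightarrow> mono (f i)" "\<And>i T. i \<in> I \<Longrightarrow> 0 \<le> f i T"
  shows "(\<Prod>i\<in>I. bernoulli_sum U q (f i)) \<le> bernoulli_sum U q (\<lambda>T. \<Prod>i\<in>I. f i T)"
  using assms(1,5,6)
proof (induction I)
  case empty
  then show ?case using assms by (simp add: bernoulli_sum_const)
next
  case (insert i I)
  have "0 \<le> bernoulli_sum U q (f i)"
    unfolding bernoulli_sum_def using insert.prems assms by (intro sum_nonneg mult_nonneg_nonneg) auto
  then have "(\<Prod>i\<in>insert i I. bernoulli_sum U q (f i)) \<le>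
      bernoulli_sum U q (f i) * bernoulli_sum U q (\<lambda>T. \<Prod>i\<in>I. f i T)"
    using insert by (auto intro: mult_left_mono)
  also have "\<dots> \<le> bernoulli_sum U q (\<lambda>T. f i T * (\<Prod>i\<in>I. f i T))"
  proof (rule harris_inequality)
    show "mono (\<lambda>T. \<Prod>i\<in>I. f i T)"
      using insert.prems by (auto simp: mono_def intro!: prod_mono)
  qed (use assms insert.prems in auto)
  finally show ?case using insert.hyps by simp
qed

section \<open>Numerical estimates for meeting a proposal twice\<close>

lemma exp_le_one_minus:
  fixes x :: real
  assumes "0 \<le> x" "x \<le> 1/2"
  shows "exp (- 2 * x) \<le> 1 - x"
proof -
  have "x * x \<le> x * (1/2)" using assms by (intro mult_left_mono) auto
  then have "- 2 * x \<le> ln (1 - x)"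
    using ln_one_minus_pos_lower_bound[OF assms] by (simp add: power2_eq_square)
  then show ?thesis using assms by (simp add: ln_ge_iff)
qed

text \<open>Here \<open>r\<close> stands for the size of a residue \<open>P - S\<close> and
  \<open>a\<close> for that of a part making up at least a quarter of it. With
  \<open>y = q * a\<close> at least 1, \<open>1 / (1 + y)\<close> is at most 1/2, so the previous
  estimate applies, and \<open>2 / (1 + y)\<close> is at most \<open>8 / (q * r)\<close>.\<close>

lemma exp_le_one_minus_power:
  fixes q :: real
  assumes "0 < q" "q \<le> 1" "4 \<le> q * real r" "r \<le> 4 * a"
  shows "exp (- 8 / (q * real r)) \<le> 1 - (1 - q) ^ a"
proof -
  define y where "y = q * real a"
  have "q * real r \<le> q * (4 * real a)"
    using assms by (intro mult_left_mono) auto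
  then have "q * real r \<le> 4 * y"
    by (simp add: y_def)
  then have y: "q * real r \<le> 4 * y" "1 \<le> y"
    using assms by auto
  have "(1 - q) ^ a \<le> exp (- q) ^ a"
    using assms exp_ge_add_one_self[of "- q"] by (intro power_mono) auto
  also have "\<dots> = exp (- y)"
    by (simp add: y_def exp_of_nat_mult[symmetric] mult.commute)
  also have "\<dots> \<le> 1 / (1 + y)"
    using exp_ge_add_one_self[of y] y by (simp add: exp_minus field_simps)
  finally have 1: "(1 - q) ^ a \<le> 1 / (1 + y)" .
  have "exp (- 8 / (q * real r)) \<le> exp (- 2 * (1 / (1 + y)))"
    using y assms by (simp add: field_simps)
  also have "\<dots> \<le> 1 - 1 / (1 + y)"
    using y by (intro exp_le_one_minus) (auto simp: field_simps)
  finally show ?thesis using 1 by simp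
qed

text \<open>Halve \<open>D\<close>; the factor 4 in place of 2 absorbs the rounding of an odd
  cardinality.\<close>

lemma disjoint_subsets_quarter:
  fixes D :: "'a set"
  assumes "2 \<le> card D"
  shows "\<exists>A B. A \<subseteq> D \<and> B \<subseteq> D \<and> A \<inter> B = {} \<and> card D \<le> 4 * card A \<and> card D \<le> 4 * card B"
proof -
  have fin: "finite D" using assms by (metis card.infinite not_numeral_le_zero)
  obtain A where A: "A \<subseteq> D" "card A = card D div 2"
    by (metis obtain_subset_with_card_n div_le_dividend)
  have "card (D - A) = card D - card D div 2"
    using A fin by (simp add: card_Diff_subset finite_subset)
  then show ?thesis
    using A assms by (intro exI[of _ A] exI[of _ "D - A"]) auto
qed

lemma two_le_card_Int:
  assumes "finite T" "A \<subseteq> P" "B \<subseteq> P" "A \<inter> B = {}" "T \<inter> A \<noteq> {}" "T \<inter> B \<noteq> {}"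
  shows "2 \<le> card (P \<inter> T)"
proof -
  obtain a b where ab: "a \<in> T" "a \<in> A" "b \<in> T" "b \<in> B" using assms by auto
  then have "card {a, b} \<le> card (P \<inter> T)"
    using assms by (intro card_mono) auto
  moreover have "a \<noteq> b" using ab assms by auto
  ultimately show ?thesis by simp
qed

subsection \<open>Targets missed by a family of proposals\<close>

text \<open>
  Two disjoint parts of \<open>P - S\<close> that are both met stand in for the event that \<open>P\<close> is met twice.
  The factor \<open>q\<close> pays for the target being non-empty.
\<close>
lemma bernoulli_sum_unhit:
  fixes U :: "'a set" and F :: "'a set set"
  assumes U: "finite U" and F: "F \<subseteq> Pow U" and S: "S \<subset> U" and q: "0 < q" "q \<le> 1/2"
    and dich: "\<And>P. P \<in> F \<Longrightarrow> P \<subseteq> S \<or> 4 \<le> q * real (card (P - S))"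
  shows "q * exp (- (2 * q * real (card S)
           + (\<Sum>P\<in>F. if P \<subseteq> S then 0 else 16 / (q * real (card (P - S)))))) \<le>
    bernoulli_sum U q (\<lambda>T. of_bool (T \<noteq> {} \<and> (\<forall>P\<in>F. card (P \<inter> T) \<noteq> 1)))"
proof -
  define V where "V = U - S"
  define G where "G = {P \<in> F. \<not> P \<subseteq> S}"
  have fin: "finite F" "finite G" "finite V" "finite S"
    using U S finite_subset[OF F] unfolding G_def V_def by (auto intro: finite_subset)
  have ex: "\<exists>A B. A \<subseteq> P - S \<and> B \<subseteq> P - S \<and> A \<inter> B = {} \<and>
      card (P - S) \<le> 4 * card A \<and> card (P - S) \<le> 4 * card B" if P: "P \<in> G" for P
  proof (rule disjoint_subsets_quarter)
    have "4 \<le> q * real (card (P - S))"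
      using P dich by (auto simp: G_def)
    also have "\<dots> \<le> 1/2 * real (card (P - S))"
      using q by (intro mult_right_mono) auto
    finally show "2 \<le> card (P - S)" by linarith
  qed
  obtain A B where AB: "\<And>P. P \<in> G \<Longrightarrow> A P \<subseteq> P - S" "\<And>P. P \<in> G \<Longrightarrow> B P \<subseteq> P - S"
      "\<And>P. P \<in> G \<Longrightarrow> A P \<inter> B P = {}"
      "\<And>P. P \<in> G \<Longrightarrow> card (P - S) \<le> 4 * card (A P)"
      "\<And>P. P \<in> G \<Longrightarrow> card (P - S) \<le> 4 * card (B P)"
    using ex by metis
  define h where "h C T = (of_bool (T \<inter> C \<noteq> {}) :: real)" for C T :: "'a set"
  have h: "mono (h C)" "0 \<le> h C T" for C T
    by (auto simp: h_def mono_def)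
  have mono_hh: "mono (\<lambda>T. h C T * h D T)" for C D
    by (auto simp: h_def mono_def)
  have sub: "A P \<subseteq> V" "B P \<subseteq> V" if "P \<in> G" for P
    using AB(1,2)[OF that] that F by (auto simp: V_def G_def)
  \<comment> \<open>Both parts of the residue have to be met, at a cost of
    \<open>8 / (q * real (card (P - S)))\<close> each.\<close>
  define c where "c P = 16 / (q * real (card (P - S)))" for P
  have E: "exp (- c P) \<le> bernoulli_sum V q (\<lambda>T. h (A P) T * h (B P) T)" if P: "P \<in> G" for P
  proof -
    have m: "4 \<le> q * real (card (P - S))" using P dich by (auto simp: G_def)
    have "exp (- c P) = exp (- 8 / (q * real (card (P - S)))) * exp (- 8 / (q * real (card (P - S))))"
      by (simp add: c_def exp_add[symmetric])
    also have "\<dots> \<le> (1 - (1 - q) ^ card (A P)) * (1 - (1 - q) ^ card (B P))"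
      using q m AB(4,5)[OF P]
      by (intro mult_mono exp_le_one_minus_power) (auto intro!: power_le_one)
    also have "\<dots> = bernoulli_sum V q (h (A P)) * bernoulli_sum V q (h (B P))"
      unfolding h_def using sub[OF P] fin by (simp add: bernoulli_sum_hit)
    also have "\<dots> \<le> bernoulli_sum V q (\<lambda>T. h (A P) T * h (B P) T)"
      using h fin q by (intro harris_inequality) auto
    finally show ?thesis .
  qed
  have "exp (- (\<Sum>P\<in>G. c P)) = (\<Prod>P\<in>G. exp (- c P))"
    using fin by (simp add: exp_sum sum_negf[symmetric])
  also have "\<dots> \<le> (\<Prod>P\<in>G. bernoulli_sum V q (\<lambda>T. h (A P) T * h (B P) T))"
    using E by (intro prod_mono) auto
  also have "\<dots> \<le> bernoulli_sum V q (\<lambda>T. \<Prod>P\<in>G. h (A P) T * h (B P) T)"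
    using fin q h mono_hh by (intro harris_inequality_prod) auto
  finally have G: "exp (- (\<Sum>P\<in>G. c P)) \<le> bernoulli_sum V q (\<lambda>T. \<Prod>P\<in>G. h (A P) T * h (B P) T)" .
  have "card V \<noteq> 0" using S fin unfolding V_def by auto
  then have "(1 - q) ^ card V \<le> (1 - q) ^ 1"
    using q by (intro power_decreasing) auto
  then have "q \<le> bernoulli_sum V q (h V)"
    unfolding h_def using fin by (simp add: bernoulli_sum_hit)
  with G have "q * exp (- (\<Sum>P\<in>G. c P)) \<le>
      bernoulli_sum V q (h V) * bernoulli_sum V q (\<lambda>T. \<Prod>P\<in>G. h (A P) T * h (B P) T)"
    using q by (intro mult_mono) auto
  also have "\<dots> \<le> bernoulli_sum V q (\<lambda>T. h V T * (\<Prod>P\<in>G. h (A P) T * h (B P) T))"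
    using fin q h mono_hh[unfolded mono_def]
    by (intro harris_inequality) (auto simp: mono_def intro!: prod_mono)
  finally have V: "q * exp (- (\<Sum>P\<in>G. c P)) \<le>
      bernoulli_sum V q (\<lambda>T. h V T * (\<Prod>P\<in>G. h (A P) T * h (B P) T))" .
  \<comment> \<open>Avoiding \<open>S\<close> is a decreasing event, out of reach of Harris'
    inequality here, but it concerns only elements of \<open>S\<close> and so is independent of the
    events in \<open>V\<close>.\<close>
  have "exp (- (2 * q * real (card S))) = exp (- 2 * q) ^ card S"
    by (simp add: exp_of_nat_mult[symmetric] mult.commute mult.left_commute)
  also have "\<dots> \<le> (1 - q) ^ card S"
    using q by (intro power_mono exp_le_one_minus) auto
  finally have "exp (- (2 * q * real (card S))) \<le> (1 - q) ^ card S" .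
  with V have "exp (- (2 * q * real (card S))) * (q * exp (- (\<Sum>P\<in>G. c P))) \<le>
      (1 - q) ^ card S * bernoulli_sum V q (\<lambda>T. h V T * (\<Prod>P\<in>G. h (A P) T * h (B P) T))"
    using q by (intro mult_mono) auto
  also have "\<dots> = bernoulli_sum U q (\<lambda>T. of_bool (T \<inter> S = {}) *
      (h V T * (\<Prod>P\<in>G. h (A P) T * h (B P) T)))"
    unfolding V_def using S U by (subst bernoulli_sum_avoid) auto
  also have "\<dots> \<le> bernoulli_sum U q (\<lambda>T. of_bool (T \<noteq> {} \<and> (\<forall>P\<in>F. card (P \<inter> T) \<noteq> 1)))"
  proof (intro bernoulli_sum_mono)
    fix T assume T: "T \<subseteq> U"
    let ?l = "of_bool (T \<inter> S = {}) * (h V T * (\<Prod>P\<in>G. h (A P) T * h (B P) T))"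
    let ?Q = "T \<noteq> {} \<and> (\<forall>P\<in>F. card (P \<inter> T) \<noteq> 1)"
    have "(\<Prod>P\<in>G. h (A P) T * h (B P) T) \<le> 1"
      by (intro prod_le_1) (auto simp: h_def)
    then have le1: "?l \<le> 1" by (auto simp: h_def)
    have "?Q" if "?l \<noteq> 0"
    proof -
      have 1: "T \<inter> S = {}" "T \<inter> V \<noteq> {}" "\<And>P. P \<in> G \<Longrightarrow> h (A P) T \<noteq> 0 \<and> h (B P) T \<noteq> 0"
        using that fin by (auto simp: h_def split: if_splits)
      have "card (P \<inter> T) \<noteq> 1" if P: "P \<in> F" for P
      proof (cases "P \<in> G")
        case True
        then have "2 \<le> card (P \<inter> T)"
          using 1(3)[OF True] AB(1-3)[OF True] T U
          by (intro two_le_card_Int[of _ "A P" _ "B P"]) (auto simp: h_def intro: finite_subset)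
        then show ?thesis by simp
      next
        case False
        then have "P \<inter> T = {}" using P 1 by (auto simp: G_def)
        then show ?thesis by simp
      qed
      then show ?thesis using 1 by auto
    qed
    then show "?l \<le> of_bool ?Q"
      using le1 by (cases "?l = 0") auto
  qed (use q in auto)
  finally have main: "exp (- (2 * q * real (card S))) * (q * exp (- (\<Sum>P\<in>G. c P))) \<le> \<dots>" .
  have "(\<Sum>P\<in>F. if P \<subseteq> S then 0 else 16 / (q * real (card (P - S)))) = (\<Sum>P\<in>G. c P)"
    unfolding G_def c_def using fin by (intro sum.mono_neutral_cong_right) auto
  then show ?thesis
    using main by (simp add: exp_add[symmetric] exp_diff exp_minus field_simps)
qed

section \<open>Swallowing sets and the choice of a scale\<close>

text \<open>
  Swallowing a proposal whose residue has at most \<open>b\<close> elements costs at most \<open>b\<close>; a set of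
  maximal cardinality within this budget leaves no such proposal.
\<close>
lemma residual_closure:
  fixes F :: "'a set set"
  assumes U: "finite U" and F: "F \<subseteq> Pow U" and S0: "S0 \<subseteq> U"
  shows "\<exists>S. S0 \<subseteq> S \<and> S \<subseteq> U \<and> (\<forall>P\<in>F. P \<subseteq> S \<or> b < card (P - S)) \<and>
    card S + b * card {P \<in> F. P \<subseteq> S0} \<le> card S0 + b * card {P \<in> F. P \<subseteq> S}"
proof -
  define good where "good S \<longleftrightarrow> S0 \<subseteq> S \<and> S \<subseteq> U \<and>
    card S + b * card {P \<in> F. P \<subseteq> S0} \<le> card S0 + b * card {P \<in> F. P \<subseteq> S}" for S
  have finF: "finite F" using U F by (auto intro: finite_subset)
  have "good S0" using S0 by (simp add: good_def)
  moreover have "\<forall>S. good S \<longrightarrow> card S \<le> card U"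
    using U by (auto simp: good_def intro: card_mono)
  ultimately obtain S where S: "good S" and max: "\<And>S'. good S' \<Longrightarrow> card S' \<le> card S"
    using ex_has_greatest_nat[of good S0 card "Suc (card U)"] by (auto simp: less_Suc_eq_le)
  have "P \<subseteq> S \<or> b < card (P - S)" if P: "P \<in> F" for P
  proof (rule ccontr)
    assume neg: "\<not> (P \<subseteq> S \<or> b < card (P - S))"
    have fin: "finite S" "finite P" using S P F U by (auto simp: good_def intro: finite_subset)
    have c: "card (S \<union> P) = card S + card (P - S)"
      using fin by (metis Un_Diff_cancel card_Un_disjoint Diff_disjoint finite_Diff)
    have "{Q \<in> F. Q \<subseteq> S} \<subset> {Q \<in> F. Q \<subseteq> S \<union> P}"
      using P neg by auto
    then have "card {Q \<in> F. Q \<subseteq> S} < card {Q \<in> F. Q \<subseteq> S \<union> P}"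
      using finF by (intro psubset_card_mono) auto
    then have "b * (card {Q \<in> F. Q \<subseteq> S} + 1) \<le> b * card {Q \<in> F. Q \<subseteq> S \<union> P}"
      by (intro mult_left_mono) auto
    \<comment> \<open>Since \<open>P\<close> is newly swallowed, the right side of the budget grows
      by at least \<open>b\<close>, and the left side only by \<open>card (P - S)\<close>, which is
      at most \<open>b\<close>.\<close>
    then have "good (S \<union> P)"
      using S P F neg c by (auto simp: good_def)
    from max[OF this] have "card (P - S) = 0" using c by simp
    then show False using fin neg by auto
  qed
  then show ?thesis using S by (auto simp: good_def)
qed

text \<open>Iterates the closure with threshold \<open>4 / q\<close> for
  \<open>q = 1 / 2 ^ i\<close> at each scale \<open>i\<close> from 1 on, so that a random target
  meets the residue of an unswallowed proposal more than 4 times on average. Dependent choice makes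
  each set extend the previous one.\<close>

lemma residual_chain:
  fixes F :: "'a set set"
  assumes U: "finite U" and F: "F \<subseteq> Pow U"
  obtains S :: "nat \<Rightarrow> 'a set" where "S 0 = {}"
    "\<And>i. S i \<subseteq> U" "\<And>i. S i \<subseteq> S (Suc i)"
    "\<And>i P. P \<in> F \<Longrightarrow> P \<subseteq> S (Suc i) \<or> 4 * 2 ^ Suc i < card (P - S (Suc i))"
    "\<And>i. card (S (Suc i)) + 4 * 2 ^ Suc i * card {P \<in> F. P \<subseteq> S i}
      \<le> card (S i) + 4 * 2 ^ Suc i * card {P \<in> F. P \<subseteq> S (Suc i)}"
proof -
  have "\<exists>S. \<forall>i. (S i \<subseteq> U \<and> (i = 0 \<longrightarrow> S i = {})) \<and> (S i \<subseteq> S (Suc i) \<and>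
    (\<forall>P\<in>F. P \<subseteq> S (Suc i) \<or> 4 * 2 ^ Suc i < card (P - S (Suc i))) \<and>
    card (S (Suc i)) + 4 * 2 ^ Suc i * card {P \<in> F. P \<subseteq> S i}
      \<le> card (S i) + 4 * 2 ^ Suc i * card {P \<in> F. P \<subseteq> S (Suc i)})"
  proof (rule dependent_nat_choice)
    fix S i assume "S \<subseteq> U \<and> (i = (0::nat) \<longrightarrow> S = {})"
    then show "\<exists>S'. (S' \<subseteq> U \<and> (Suc i = 0 \<longrightarrow> S' = {})) \<and> S \<subseteq> S' \<and>
      (\<forall>P\<in>F. P \<subseteq> S' \<or> 4 * 2 ^ Suc i < card (P - S')) \<and>
      card S' + 4 * 2 ^ Suc i * card {P \<in> F. P \<subseteq> S}
      \<le> card S + 4 * 2 ^ Suc i * card {P \<in> F. P \<subseteq> S'}"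
      using residual_closure[OF U F, of S "4 * 2 ^ Suc i"] by auto
  qed auto
  then show thesis
  proof (elim exE, goal_cases)
    case (1 S)
    then show ?case by (intro that[of S]) blast+
  qed
qed

text \<open>Averaging over the scales: in total a proposal adds at most 16 through the sizes of the
  swallowing sets and at most 8 through the residual terms. The sum of all costs is thus at most
  \<open>24 * card F\<close>, and one of the \<open>L\<close> scales costs less than
  \<open>L\<close>.\<close>

lemma good_scale:
  fixes F :: "'a set set"
  assumes U: "finite U" and F: "F \<subseteq> Pow U" and L: "24 * card F < L ^ 2"
  shows "\<exists>i S. i \<in> {1..L} \<and> S \<subseteq> U \<and> (\<forall>P\<in>F. P \<subseteq> S \<or> 4 * 2 ^ i < card (P - S)) \<and>
    2 * real (card S) / 2 ^ i + (\<Sum>P\<in>F. if P \<subseteq> S then 0 else 16 * 2 ^ i / real (card (P - S))) < real L"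
proof -
  obtain S :: "nat \<Rightarrow> 'a set" where S0: "S 0 = {}"
    and SU: "\<And>i. S i \<subseteq> U" and Smono: "\<And>i. S i \<subseteq> S (Suc i)"
    and dich: "\<And>i P. P \<in> F \<Longrightarrow> P \<subseteq> S (Suc i) \<or> 4 * 2 ^ Suc i < card (P - S (Suc i))"
    and cnt: "\<And>i. card (S (Suc i)) + 4 * 2 ^ Suc i * card {P \<in> F. P \<subseteq> S i}
      \<le> card (S i) + 4 * 2 ^ Suc i * card {P \<in> F. P \<subseteq> S (Suc i)}"
  proof (rule residual_chain[OF U F], goal_cases)
    case (1 S)
    show ?case by (rule 1(1)[OF 1(2-6)])
  qed
  have finF: "finite F" using U F by (auto intro: finite_subset)
  define x where "x i = real (card (S i)) / 2 ^ i" for i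
  define N where "N i = real (card {P \<in> F. P \<subseteq> S i})" for i
  define c where "c P i = (if P \<subseteq> S i then 0 else 16 * 2 ^ i / real (card (P - S i)))" for P i
  \<comment> \<open>The budget divided by \<open>2 ^ Suc i\<close>: old elements count half as much
    at the next scale, and each newly swallowed proposal adds at most 4.\<close>
  have xstep: "x (Suc i) \<le> x i / 2 + 4 * (N (Suc i) - N i)" for i
  proof -
    have "real (card (S (Suc i))) + 4 * 2 ^ Suc i * N i \<le> real (card (S i)) + 4 * 2 ^ Suc i * N (Suc i)"
      using cnt[of i, folded of_nat_le_iff[where ?'a = real]] by (simp add: N_def)
    then show ?thesis by (simp add: x_def field_simps)
  qed
  \<comment> \<open>The summand \<open>x m\<close> is the total \<open>x m / 2 + x m / 4 + \<dots>\<close> of what \<open>S m\<close> still costs later.\<close>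
  have "(\<Sum>i=1..m. x i) + x m \<le> 8 * N m" for m
  proof (induction m)
    case 0
    then show ?case by (simp add: x_def S0 N_def)
  next
    case (Suc m)
    then show ?case using xstep[of m] by simp
  qed
  moreover have "0 \<le> x m" "N m \<le> real (card F)" for m
    using finF by (auto simp: x_def N_def intro!: card_mono)
  ultimately have xsum: "(\<Sum>i=1..L. x i) \<le> 8 * real (card F)"
    by (smt (verit))
  \<comment> \<open>As long as \<open>P\<close> is not swallowed its residue shrinks while \<open>2 ^ i\<close> doubles, so \<open>c P\<close> grows
    geometrically and its sum is dominated by the last term, which is at most 4.\<close>
  have csum: "(\<Sum>i=1..m. c P i) \<le> 8 \<and> (\<not> P \<subseteq> S m \<longrightarrow> (\<Sum>i=1..m. c P i) \<le> 2 * c P m)"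
    if P: "P \<in> F" for P m
  proof (induction m)
    case 0
    then show ?case by (simp add: c_def)
  next
    case (Suc m)
    show ?case
    proof (cases "P \<subseteq> S (Suc m)")
      case True
      then show ?thesis using Suc by (simp add: c_def)
    next
      case False
      then have nm: "\<not> P \<subseteq> S m" using Smono by blast
      have fP: "finite P" using P F U by (auto intro: finite_subset)
      have big: "4 * 2 ^ Suc m < card (P - S (Suc m))" using dich[OF P] False by blast
      then have big': "4 * 2 ^ Suc m < real (card (P - S (Suc m)))"
        by (metis of_nat_less_iff of_nat_mult of_nat_numeral of_nat_power)
      have pos: "0 < real (card (P - S (Suc m)))" using big by simp
      have le: "real (card (P - S (Suc m))) \<le> real (card (P - S m))"
        using fP Smono[of m] by (auto intro!: card_mono)
      have "2 * c P m = 16 * 2 ^ Suc m / real (card (P - S m))"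
        using nm by (simp add: c_def)
      also have "\<dots> \<le> 16 * 2 ^ Suc m / real (card (P - S (Suc m)))"
        using pos le by (intro divide_left_mono) auto
      also have "\<dots> = c P (Suc m)" using False by (simp add: c_def)
      finally have half: "2 * c P m \<le> c P (Suc m)" .
      have "c P (Suc m) \<le> 4"
        using False big' pos by (simp add: c_def field_simps)
      then show ?thesis using half Suc nm by simp
    qed
  qed
  define cost where "cost i = 2 * x i + (\<Sum>P\<in>F. c P i)" for i
  have "(\<Sum>i=1..L. cost i) = 2 * (\<Sum>i=1..L. x i) + (\<Sum>P\<in>F. \<Sum>i=1..L. c P i)"
    unfolding cost_def sum.distrib sum_distrib_left by (subst (2) sum.swap) simp
  also have "\<dots> \<le> 2 * (8 * real (card F)) + (\<Sum>P\<in>F. 8)"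
    using xsum csum by (intro add_mono mult_left_mono sum_mono) auto
  also have "\<dots> = 24 * real (card F)" by simp
  also have "\<dots> < real L ^ 2"
    using L[folded of_nat_less_iff[where ?'a = real]] by simp
  finally have total: "(\<Sum>i=1..L. cost i) < real L ^ 2" .
  have "\<exists>i\<in>{1..L}. cost i < real L"
  proof (rule ccontr)
    assume "\<not> ?thesis"
    then have "(\<Sum>i=1..L. real L) \<le> (\<Sum>i=1..L. cost i)"
      by (intro sum_mono) (auto simp: not_less)
    then show False using total by (simp add: power2_eq_square)
  qed
  then obtain i where i: "i \<in> {1..L}" "cost i < real L" by blast
  then obtain j where "i = Suc j" by (cases i) auto
  then show ?thesis
    using i SU dich[of _ j]
    by (intro exI[of _ i] exI[of _ "S i"]) (auto simp: cost_def x_def c_def)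
qed

text \<open>At the good scale the cost is below \<open>L\<close> and \<open>q\<close> is at least
  \<open>1 / 2 ^ L\<close>. The size of \<open>U\<close> ensures that the swallowing set leaves
  elements over for the target.\<close>

lemma bernoulli_sum_unhit_ge:
  fixes F :: "'a set set"
  assumes U: "finite U" and F: "F \<subseteq> Pow U" and L: "24 * card F < L ^ 2"
    and card_U: "L * 2 ^ L \<le> card U"
  shows "\<exists>i\<in>{1..L}. exp (- real L) / 2 ^ L \<le>
    bernoulli_sum U (1 / 2 ^ i) (\<lambda>T. of_bool (T \<noteq> {} \<and> (\<forall>P\<in>F. card (P \<inter> T) \<noteq> 1)))"
proof -
  obtain i S where i: "i \<in> {1..L}" and S: "S \<subseteq> U"
    and dich: "\<And>P. P \<in> F \<Longrightarrow> P \<subseteq> S \<or> 4 * 2 ^ i < card (P - S)"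
    and cost: "2 * real (card S) / 2 ^ i
      + (\<Sum>P\<in>F. if P \<subseteq> S then 0 else 16 * 2 ^ i / real (card (P - S))) < real L"
    using good_scale[OF U F L] by blast
  define q :: real where "q = 1 / 2 ^ i"
  let ?c = "\<Sum>P\<in>F. if P \<subseteq> S then 0 else 16 / (q * real (card (P - S)))"
  have le: "(2::real) ^ i \<le> 2 ^ L" "(2::real) ^ 1 \<le> 2 ^ i"
    using i by (intro power_increasing; simp)+
  have q: "0 < q" "q \<le> 1/2" "1 / 2 ^ L \<le> q"
    using le by (auto simp: q_def field_simps)
  have c: "?c = (\<Sum>P\<in>F. if P \<subseteq> S then 0 else 16 * 2 ^ i / real (card (P - S)))"
    by (intro sum.cong) (auto simp: q_def)
  have cost': "2 * q * real (card S) + ?c < real L"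
    unfolding c using cost by (simp add: q_def)
  have "0 \<le> ?c" using q by (intro sum_nonneg) auto
  then have "2 * q * real (card S) < real L" using cost' by linarith
  then have "real (card S) < real L * 2 ^ i"
    by (simp add: q_def field_simps)
  also have "\<dots> \<le> real L * 2 ^ L" using le by (intro mult_left_mono) auto
  also have "\<dots> \<le> real (card U)"
    using card_U[folded of_nat_le_iff[where ?'a = real]] by simp
  finally have "S \<subset> U" using S by auto
  moreover have "P \<subseteq> S \<or> 4 \<le> q * real (card (P - S))" if "P \<in> F" for P
  proof -
    have "4 * 2 ^ i \<le> real (card (P - S))" if "4 * 2 ^ i < card (P - S)"
      using less_imp_le[OF that, folded of_nat_le_iff[where ?'a = real]] by simp
    then show ?thesis using dich[OF that] by (auto simp: q_def field_simps)
  qed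
  ultimately have "q * exp (- (2 * q * real (card S) + ?c)) \<le>
    bernoulli_sum U q (\<lambda>T. of_bool (T \<noteq> {} \<and> (\<forall>P\<in>F. card (P \<inter> T) \<noteq> 1)))"
    by (intro bernoulli_sum_unhit[OF U F _ q(1,2)])
  moreover have "1 / 2 ^ L * exp (- real L) \<le> q * exp (- (2 * q * real (card S) + ?c))"
    using q cost' by (intro mult_mono) auto
  ultimately show ?thesis using i unfolding q_def by (intro bexI[of _ i]) auto
qed

subsection \<open>Derandomizing the player\<close>

text \<open>First-moment principle. The point is taken from the support so that the proposals and
  states fixed with it are ones the player can produce.\<close>

lemma exists_le_expectation:
  fixes h :: "'a \<Rightarrow> real"
  assumes int: "integrable (measure_pmf p) h"
  shows "\<exists>x\<in>set_pmf p. h x \<le> measure_pmf.expectation p h"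
proof (rule ccontr)
  let ?e = "measure_pmf.expectation p h"
  assume "\<not> ?thesis"
  then have gt: "\<And>x. x \<in> set_pmf p \<Longrightarrow> ?e < h x" by force
  have int': "integrable (measure_pmf p) (\<lambda>x. h x - ?e)" using int by simp
  have "measure_pmf.expectation p (\<lambda>x. h x - ?e) = 0" using int by simp
  moreover have "AE x in measure_pmf p. 0 \<le> h x - ?e"
    using gt by (auto simp: AE_measure_pmf_iff intro: less_imp_le)
  ultimately have "AE x in measure_pmf p. h x - ?e = 0"
    using integral_nonneg_eq_0_iff_AE[OF int'] by simp
  then show False
    using gt set_pmf_not_empty[of p] by (fastforce simp: AE_measure_pmf_iff)
qed

lemma exists_le_weighted_pmf_bind:
  fixes w :: "'b \<Rightarrow> real" and g :: "'b \<Rightarrow> 'a \<Rightarrow> bool pmf"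
  shows "\<exists>x\<in>set_pmf p. (\<Sum>T\<in>TT. w T * (1 - pmf (g T x) True)) \<le>
    (\<Sum>T\<in>TT. w T * (1 - pmf (bind_pmf p (g T)) True))"
proof -
  have int1: "integrable (measure_pmf p) (\<lambda>x. pmf (g T x) True)" for T
    by (rule measure_pmf.integrable_const_bound[where B = 1]) (auto simp: pmf_le_1)
  have int: "integrable (measure_pmf p) (\<lambda>x. \<Sum>T\<in>TT. w T * (1 - pmf (g T x) True))"
    using int1 by (intro Bochner_Integration.integrable_sum) auto
  have "measure_pmf.expectation p (\<lambda>x. \<Sum>T\<in>TT. w T * (1 - pmf (g T x) True)) =
      (\<Sum>T\<in>TT. w T * (1 - pmf (bind_pmf p (g T)) True))"
    using int1 by (subst Bochner_Integration.integral_sum) (auto simp: pmf_bind)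
  then show ?thesis using exists_le_expectation[OF int] by simp
qed

text \<open>Method of conditional expectations, one round at a time. Since a transition does not
  depend on the target, one choice of proposal and next state serves all targets at once.\<close>

lemma exists_proposals_play_rounds:
  fixes w :: "nat set \<Rightarrow> real"
  assumes "hitting_player k A" "s \<in> states A"
  shows "\<exists>Ps. length Ps = n \<and> set Ps \<subseteq> Pow {1..k} \<and>
    (\<Sum>T\<in>TT. w T * of_bool (\<forall>P\<in>set Ps. card (P \<inter> T) \<noteq> 1)) \<le>
    (\<Sum>T\<in>TT. w T * (1 - pmf (play_rounds A T n s) True))"
  using assms(2)
proof (induction n arbitrary: s w)
  case 0
  then show ?case by (intro exI[of _ "[]"]) simp
next
  case (Suc n)
  let ?g = "\<lambda>T (P, s'). if card (P \<inter> T) = 1 then return_pmf True else play_rounds A T n s'"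
  obtain P s' where Ps': "(P, s') \<in> set_pmf (trans_dist A s)"
    and le: "(\<Sum>T\<in>TT. w T * (1 - pmf (?g T (P, s')) True)) \<le>
      (\<Sum>T\<in>TT. w T * (1 - pmf (play_rounds A T (Suc n) s) True))"
    using exists_le_weighted_pmf_bind[where p = "trans_dist A s" and w = w and g = ?g and TT = TT] by auto
  have P: "P \<subseteq> {1..k}" "s' \<in> states A"
    using Ps' assms(1) Suc.prems unfolding hitting_player_def by blast+
  \<comment> \<open>Targets won by \<open>P\<close> drop out of the weight and the remaining rounds
    are judged on the survivors; this is why the induction ranges over all \<open>w\<close>.\<close>
  define w' where "w' T = w T * of_bool (card (P \<inter> T) \<noteq> 1)" for T
  obtain Ps where Ps: "length Ps = n" "set Ps \<subseteq> Pow {1..k}"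
    and le': "(\<Sum>T\<in>TT. w' T * of_bool (\<forall>P\<in>set Ps. card (P \<inter> T) \<noteq> 1)) \<le>
      (\<Sum>T\<in>TT. w' T * (1 - pmf (play_rounds A T n s') True))"
    using Suc.IH[OF P(2), of w'] by blast
  have "(\<Sum>T\<in>TT. w T * of_bool (\<forall>Q\<in>set (P # Ps). card (Q \<inter> T) \<noteq> 1)) =
      (\<Sum>T\<in>TT. w' T * of_bool (\<forall>P\<in>set Ps. card (P \<inter> T) \<noteq> 1))"
    by (intro sum.cong) (auto simp: w'_def)
  also note le'
  also have "(\<Sum>T\<in>TT. w' T * (1 - pmf (play_rounds A T n s') True)) =
      (\<Sum>T\<in>TT. w T * (1 - pmf (?g T (P, s')) True))"
    by (intro sum.cong) (auto simp: w'_def)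
  also note le
  finally show ?case
    using Ps P by (intro exI[of _ "P # Ps"]) auto
qed

text \<open>Referees with a deterministic target bound the failure probability by
  \<open>\<epsilon>\<close> for each target, hence also on weighted average.\<close>

lemma exists_proposals:
  fixes w :: "nat set \<Rightarrow> real"
  assumes A: "hitting_player k A" and w: "\<And>T. 0 \<le> w T"
    and win: "\<And>R. hitting_referee k R \<Longrightarrow> 1 - \<epsilon> \<le> win_prob A R n"
    and TT: "TT \<subseteq> Pow {1..k} - {{}}"
  shows "\<exists>Ps. length Ps = n \<and> set Ps \<subseteq> Pow {1..k} \<and>
    (\<Sum>T\<in>TT. w T * of_bool (\<forall>P\<in>set Ps. card (P \<inter> T) \<noteq> 1)) \<le> \<epsilon> * sum w TT"
proof -
  let ?g = "\<lambda>T. play_rounds A T n"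
  obtain s where s: "s \<in> set_pmf (start A)"
    and le: "(\<Sum>T\<in>TT. w T * (1 - pmf (?g T s) True)) \<le>
      (\<Sum>T\<in>TT. w T * (1 - pmf (bind_pmf (start A) (?g T)) True))"
    using exists_le_weighted_pmf_bind[where p = "start A" and w = w and g = ?g and TT = TT] by blast
  have "s \<in> states A" using s A by (auto simp: hitting_player_def)
  then obtain Ps where Ps: "length Ps = n" "set Ps \<subseteq> Pow {1..k}"
    "(\<Sum>T\<in>TT. w T * of_bool (\<forall>P\<in>set Ps. card (P \<inter> T) \<noteq> 1)) \<le>
      (\<Sum>T\<in>TT. w T * (1 - pmf (?g T s) True))"
    using exists_proposals_play_rounds[OF A, where n = n and TT = TT and w = w] by blast
  note Ps(3)
  also note le
  also have "(\<Sum>T\<in>TT. w T * (1 - pmf (bind_pmf (start A) (?g T)) True)) \<le> (\<Sum>T\<in>TT. w T * \<epsilon>)"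
  proof (intro sum_mono mult_left_mono w)
    fix T assume "T \<in> TT"
    then have "hitting_referee k (return_pmf T)"
      using TT by (auto simp: hitting_referee_def)
    from win[OF this] show "1 - pmf (bind_pmf (start A) (?g T)) True \<le> \<epsilon>"
      by (simp add: win_prob_def hitting_game_def bind_return_pmf)
  qed
  finally show ?thesis using Ps
    by (auto simp: sum_distrib_left mult.commute)
qed

section \<open>The quadratic lower bound and its asymptotic form\<close>

text \<open>With too few rounds, two bounds on the weight of the missed targets collide: at most
  \<open>L / k\<close> by derandomization, at least \<open>exp (- L) / 2 ^ L\<close> by the good
  scale. They would give \<open>k < 12 ^ L\<close>, contradicting \<open>32 ^ L\<close> as a lower
  bound for \<open>k\<close>.\<close>

lemma hitting_lower_bound:
  assumes A: "hitting_player k A"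
    and win: "\<And>R. hitting_referee k R \<Longrightarrow> 1 - 1 / real k \<le> win_prob A R n"
    and L: "1 \<le> L" "32 ^ L \<le> k"
  shows "L ^ 2 \<le> 24 * n"
proof (rule ccontr)
  assume neg: "\<not> L ^ 2 \<le> 24 * n"
  let ?U = "{1..k}"
  let ?\<mu> = "\<lambda>i T. (1 / 2 ^ i) ^ card T * (1 - 1 / 2 ^ i) ^ card (?U - T) :: real"
  \<comment> \<open>The good scale depends on the proposals, which are fixed only after
    \<open>w\<close>; hence all \<open>L\<close> scales enter the weight.\<close>
  define w where "w T = (\<Sum>i=1..L. ?\<mu> i T)" for T
  have \<mu>: "0 \<le> ?\<mu> i T" for i T by (intro mult_nonneg_nonneg zero_le_power) auto
  then have w: "0 \<le> w T" for T unfolding w_def by (intro sum_nonneg)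
  obtain Ps where Ps: "length Ps = n" "set Ps \<subseteq> Pow ?U" and le:
    "(\<Sum>T\<in>Pow ?U - {{}}. w T * of_bool (\<forall>P\<in>set Ps. card (P \<inter> T) \<noteq> 1))
      \<le> 1 / real k * sum w (Pow ?U - {{}})"
    using exists_proposals[where w = w and TT = "Pow ?U - {{}}", OF A w win] by blast
  have "24 * card (set Ps) < L ^ 2"
    using neg card_length[of Ps] Ps(1) by linarith
  moreover have "L * 2 ^ L \<le> card ?U"
  proof -
    have "L * 2 ^ L \<le> 2 ^ L * 2 ^ L" by (intro mult_right_mono) (auto intro: less_imp_le less_exp)
    also have "\<dots> = 4 ^ L" by (simp add: power_mult_distrib[symmetric])
    also have "\<dots> \<le> 32 ^ L" by (intro power_mono) auto
    finally show ?thesis using L by simp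
  qed
  ultimately obtain i where i: "i \<in> {1..L}" and lower: "exp (- real L) / 2 ^ L \<le>
    bernoulli_sum ?U (1 / 2 ^ i) (\<lambda>T. of_bool (T \<noteq> {} \<and> (\<forall>P\<in>set Ps. card (P \<inter> T) \<noteq> 1)))"
    using bernoulli_sum_unhit_ge[of ?U "set Ps" L] Ps(2) by auto
  note lower
  also have "bernoulli_sum ?U (1 / 2 ^ i) (\<lambda>T. of_bool (T \<noteq> {} \<and> (\<forall>P\<in>set Ps. card (P \<inter> T) \<noteq> 1)))
      = (\<Sum>T\<in>Pow ?U - {{}}. ?\<mu> i T * of_bool (\<forall>P\<in>set Ps. card (P \<inter> T) \<noteq> 1))"
    unfolding bernoulli_sum_def by (rule sum.mono_neutral_cong_right) auto
  also have "\<dots> \<le> (\<Sum>T\<in>Pow ?U - {{}}. w T * of_bool (\<forall>P\<in>set Ps. card (P \<inter> T) \<noteq> 1))"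
    unfolding w_def using i \<mu> by (intro sum_mono mult_right_mono member_le_sum) auto
  also note le
  \<comment> \<open>Putting the empty target back completes each scale to total weight 1.\<close>
  also have "sum w (Pow ?U - {{}}) \<le> sum w (Pow ?U)"
    using w by (intro sum_mono2) auto
  also have "sum w (Pow ?U) = (\<Sum>i=1..L. bernoulli_sum ?U (1 / 2 ^ i) (\<lambda>_. 1))"
    unfolding w_def bernoulli_sum_def by (subst sum.swap) simp
  also have "\<dots> = real L" by (simp add: bernoulli_sum_const)
  finally have "exp (- real L) / 2 ^ L \<le> 1 / real k * real L"
    by (simp add: divide_right_mono)
  moreover have k: "0 < real k" using L by (cases "k = 0") auto
  ultimately have "real k \<le> real L * (2 ^ L * exp (real L))"
    by (simp add: exp_minus field_simps)
  also have "\<dots> \<le> real L * (2 ^ L * 3 ^ L)"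
  proof (intro mult_left_mono)
    have "exp (real L) = exp 1 ^ L" by (simp add: exp_of_nat_mult[symmetric])
    also have "\<dots> \<le> 3 ^ L" using exp_le by (intro power_mono) auto
    finally show "exp (real L) \<le> 3 ^ L" .
  qed auto
  also have "real L * (2 ^ L * 3 ^ L) < 2 ^ L * (2 ^ L * 3 ^ L)"
    by (intro mult_strict_right_mono) (auto simp: of_nat_less_two_power)
  also have "\<dots> = 12 ^ L" by (simp add: power_mult_distrib[symmetric])
  also have "\<dots> \<le> 32 ^ L" by (intro power_mono) auto
  also have "\<dots> \<le> real k"
    using L(2)[folded of_nat_le_iff[where ?'a = real]] by simp
  finally show False by simp
qed

theorem theorem3p3:
  fixes \<P> :: "nat \<Rightarrow> 's player" and f :: "nat \<Rightarrow> nat"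
  assumes "\<And>k. k > 1 \<Longrightarrow> hitting_player k (\<P> k)"
    and "\<And>k R. k > 1 \<Longrightarrow> hitting_referee k R \<Longrightarrow>
           win_prob (\<P> k) R (f k) \<ge> 1 - 1 / real k"
  shows "(\<lambda>k. real (f k)) \<in> \<Omega>(\<lambda>k. (log 2 (real k))\<^sup>2)"
proof (rule landau_omega.bigI[where c = "1/2400"])
  show "\<forall>\<^sub>F k in sequentially. 1/2400 * norm ((log 2 (real k))\<^sup>2) \<le> norm (real (f k))"
    using eventually_ge_at_top[of 32]
  proof eventually_elim
    case (elim k)
    \<comment> \<open>\<open>x\<close> is the logarithm of \<open>k\<close> to base 32 and
      \<open>L\<close> its integer part. As \<open>x\<close> is at least 1, rounding loses at most
      half, so \<open>L\<close> is at least \<open>log 2 k / 10\<close>, and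
      \<open>24 * 10 ^ 2\<close> gives the constant 2400.\<close>
    define x where "x = log 2 (real k) / 5"
    have x: "1 \<le> x"
      using elim le_log_iff[of 2 "real k" 5] by (simp add: x_def)
    define L where "L = nat \<lfloor>x\<rfloor>"
    have "1 \<le> \<lfloor>x\<rfloor>" using x by simp
    then have L: "1 \<le> L" "real L = of_int \<lfloor>x\<rfloor>"
      unfolding L_def by linarith+
    then have L: "1 \<le> L" "real L \<le> x" "x / 2 \<le> real L"
      by linarith+
    have "(32::real) ^ L = 2 ^ (5 * L)" by (simp add: power_mult)
    also have "\<dots> = 2 powr real (5 * L)" by (rule powr_realpow[symmetric]) simp
    also have "\<dots> \<le> 2 powr log 2 (real k)"
      using L by (intro powr_mono) (auto simp: x_def)
    also have "\<dots> = real k" using elim by simp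
    finally have "real (32 ^ L) \<le> real k" by simp
    then have "32 ^ L \<le> k" by (simp only: of_nat_le_iff)
    then have "L ^ 2 \<le> 24 * f k"
      using assms elim L by (intro hitting_lower_bound[of k "\<P> k"]) auto
    then have "real L ^ 2 \<le> 24 * real (f k)"
      by (metis of_nat_le_iff of_nat_mult of_nat_numeral of_nat_power)
    moreover have "(x / 2) ^ 2 \<le> real L ^ 2" using L x by (intro power_mono) auto
    moreover have "(log 2 (real k))\<^sup>2 = 100 * (x / 2) ^ 2"
      by (simp add: x_def power2_eq_square)
    ultimately show ?case by simp
  qed
qed simp

end
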